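(* Let $q\ge 2$ and $d=2q-3$, and let $I$ be a parity class of $Q_d$ with complementary parity class $D$. The restriction map $c\mapsto c|_D$ is a bijection from the set of extremal pair-defensive $q$-colourings $c$ of $Q_d$ (with attacked parity $I$) to the set of maps $c_D:D\to[q]$ such that, for every $b\in D$, the set $$L_b=\bigl\{\{j,\ell\}\subseteq[d]: j\ne\ell \text{ and } c_D(b+e_j+e_\ell)=c_D(b)\bigr\}$$ is a near-perfect matching of $[d]$. For such a map $c_D$, the colours on $I$, the defect matching between $D$ and $I$, and all pair-Hall inequalities are forced. That is: $c_D$ has exactly one extension to an extremal pair-defensive $q$-colouring of $Q_d$; writing $\delta(b)$ for the unique coordinate not covered by $L_b$, the edges $\{b,\,b+e_{\delta(b)}\}$, $b\in D$ (which are determined by $c_D$), form a perfect matching between $D$ and $I$; and for this extension $|N[\{x,y\}]\cap C_i|\ge 2$ for all distinct $x,y\in I$ and all $i\in[q]$.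
   Context: The hypercube $Q_d$ is the graph on $\mathbb F_2^d$ in which two vertices are adjacent when they differ in exactly one coordinate; $e_j$ is the $j$th standard basis vector, and $[n]=\{1,\dots,n\}$. Its two parity classes are the vectors of even Hamming weight and those of odd Hamming weight; $I$ is one of them (the attacked parity) and $D$ the other (the defender parity). $N(x)$ is the open neighbourhood in $Q_d$, $N[x]=N(x)\cup\{x\}$, and $N[X]=\bigcup_{x\in X}N[x]$. A pair-defensive $q$-colouring with attacked parity $I$ (an $(I,2,q)$-defensive silver colouring) is a surjective proper colouring $c:V(Q_d)\to[q]$, with colour classes $C_i=c^{-1}(i)$, such that for every colour $i\in[q]$ and every $S\subseteq I$ with $|S|\le 2$ there is an injective map $f:S\to C_i$ with $f(x)\in N[x]$ for all $x\in S$. Such a colouring is called extremal if it attains the bound $q=\lfloor (d+3)/2\rfloor$ on the number of colours; for $d=2q-3$ this means simply that it uses $q$ colours. A near-perfect matching of $[d]$ is a set of pairwise disjoint two-element subsets of $[d]$ covering all but exactly one element of $[d]$. *)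

theory Defs
  imports "HOL-Analysis.Analysis" "HOL-Library.Z2"
begin

text \<open>
  The vertices of the hypercube are the vectors of type \<^typ>\<open>bit ^ 'd\<close>, where \<^typ>\<open>bit\<close> is the
  two-element field and the finite index type \<^typ>\<open>'d\<close> plays the role of \<open>{1..d}\<close>, so that
  \<open>d = CARD('d)\<close>. The \<open>j\<close>th standard basis vector is \<^term>\<open>axis j 1\<close>.
\<close>

instance bit :: finite
proof
  have "(UNIV :: bit set) = {0, 1}"
    using bit.exhaust by blast
  then show "finite (UNIV :: bit set)"
    by (metis finite.emptyI finite.insertI)
qed

definition cube_adj :: "bit ^ 'd::finite \<Rightarrow> bit ^ 'd \<Rightarrow> bool"
  where "cube_adj x y \<longleftrightarrow> (\<exists>!j. x $ j \<noteq> y $ j)"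

definition hamming_weight :: "bit ^ 'd::finite \<Rightarrow> nat"
  where "hamming_weight x = card {j. x $ j \<noteq> 0}"

definition parity_class :: "(bit ^ 'd::finite) set \<Rightarrow> bool"
  where "parity_class I \<longleftrightarrow> I = {x. even (hamming_weight x)} \<or> I = {x. odd (hamming_weight x)}"

definition open_nbhd :: "bit ^ 'd::finite \<Rightarrow> (bit ^ 'd) set"
  where "open_nbhd x = {y. cube_adj x y}"

definition closed_nbhd :: "bit ^ 'd::finite \<Rightarrow> (bit ^ 'd) set"
  where "closed_nbhd x = open_nbhd x \<union> {x}"

definition closed_nbhd_set :: "(bit ^ 'd::finite) set \<Rightarrow> (bit ^ 'd) set"
  where "closed_nbhd_set X = (\<Union>x\<in>X. closed_nbhd x)"

definition colour_class :: "(bit ^ 'd::finite \<Rightarrow> nat) \<Rightarrow> nat \<Rightarrow> (bit ^ 'd) set"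
  where "colour_class c i = c -` {i}"

definition pair_defensive_colouring ::
    "(bit ^ 'd::finite) set \<Rightarrow> nat \<Rightarrow> (bit ^ 'd \<Rightarrow> nat) \<Rightarrow> bool"
  where "pair_defensive_colouring I q c \<longleftrightarrow>
    range c = {1..q} \<and>
    (\<forall>x y. cube_adj x y \<longrightarrow> c x \<noteq> c y) \<and>
    (\<forall>i\<in>{1..q}. \<forall>S. S \<subseteq> I \<and> card S \<le> 2 \<longrightarrow>
      (\<exists>f. f \<in> S \<rightarrow> colour_class c i \<and> inj_on f S \<and> (\<forall>x\<in>S. f x \<in> closed_nbhd x)))"

definition extremal_colouring ::
    "(bit ^ 'd::finite) set \<Rightarrow> nat \<Rightarrow> (bit ^ 'd \<Rightarrow> nat) \<Rightarrow> bool"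
  where "extremal_colouring I q c \<longleftrightarrow>
    pair_defensive_colouring I q c \<and> q = (CARD('d) + 3) div 2"

definition near_perfect_matching :: "'d::finite set set \<Rightarrow> bool"
  where "near_perfect_matching M \<longleftrightarrow>
    (\<forall>e\<in>M. card e = 2) \<and> pairwise disjnt M \<and> (\<exists>!j. j \<notin> \<Union>M)"

text \<open>The set \<open>L\<^sub>b\<close> attached to a map \<open>g\<close>, defined on the parity class containing \<open>b\<close>.\<close>

definition repeat_pairs :: "(bit ^ 'd::finite \<Rightarrow> nat) \<Rightarrow> bit ^ 'd \<Rightarrow> 'd set set"
  where "repeat_pairs g b = {{j, l} | j l. j \<noteq> l \<and> g (b + axis j 1 + axis l 1) = g b}"

text \<open>
  The maps \<open>D \<rightarrow> {1..q}\<close> with all \<open>L\<^sub>b\<close> near-perfect. They are represented extensionally, with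
  value \<^term>\<open>undefined\<close> outside \<open>D\<close>, so that two of them are equal iff they agree on \<open>D\<close>.
\<close>

definition matching_maps :: "(bit ^ 'd::finite) set \<Rightarrow> nat \<Rightarrow> (bit ^ 'd \<Rightarrow> nat) set"
  where "matching_maps D q =
    {g \<in> D \<rightarrow>\<^sub>E {1..q}. \<forall>b\<in>D. near_perfect_matching (repeat_pairs g b)}"

text \<open>Meaningful only when \<open>L\<^sub>b\<close> is a near-perfect matching.\<close>

definition defect :: "(bit ^ 'd::finite \<Rightarrow> nat) \<Rightarrow> bit ^ 'd \<Rightarrow> 'd"
  where "defect g b = (THE j. j \<notin> \<Union>(repeat_pairs g b))"

definition perfect_matching_between ::
    "(bit ^ 'd::finite) set \<Rightarrow> (bit ^ 'd) set \<Rightarrow> (bit ^ 'd) set set \<Rightarrow> bool"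
  where "perfect_matching_between A B M \<longleftrightarrow>
    (\<forall>e\<in>M. \<exists>a\<in>A. \<exists>b\<in>B. e = {a, b} \<and> cube_adj a b) \<and>
    (\<forall>v\<in>A \<union> B. \<exists>!e. e \<in> M \<and> v \<in> e)"

end

theory Submission
  imports Defs
begin

text \<open>
  Fix a colouring \<open>g\<close> of \<open>D\<close> and look at the \<open>d\<close> neighbours of a vertex \<open>x \<in> I\<close>, all of which lie
  in \<open>D\<close>. Call the coordinate \<open>j\<close> solitary at \<open>x\<close> if no other neighbour of \<open>x\<close> shares the colour of
  \<open>x + e\<^sub>j\<close>, and write \<open>s x\<close> for the number of solitary coordinates. Everything follows from
  two descriptions of this notion and one double count.

  Seen from \<open>b = x + e\<^sub>j\<close>, the coordinate \<open>j\<close> is solitary at \<open>x\<close> iff \<open>L\<^sub>b\<close> does not cover \<open>j\<close>. Hence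
  \<open>L\<^sub>b\<close> is a near-perfect matching iff every colour class around each neighbour of \<open>b\<close> that
  contains \<open>b\<close> has at most two elements and exactly one edge at \<open>b\<close> is solitary
  (\<open>near_perfect_repeat_pairs_iff\<close>). Seen from \<open>x\<close>, each colour that occurs on \<open>N(x)\<close> occurs
  at least twice unless it is solitary, so that \<open>2 p \<le> d + s x\<close> for the number \<open>p\<close> of colours on
  \<open>N(x)\<close>, with equality iff no colour occurs more than twice (\<open>palette_bound\<close>,
  \<open>palette_bound_tight_iff\<close>).

  A colouring is pair-defensive iff \<open>N(x)\<close> carries exactly the colours different from \<open>c x\<close>, for
  each \<open>x \<in> I\<close>, and each \<open>b \<in> D\<close> is on at most one solitary edge (\<open>pair_defensive_iff\<close>): if
  a colour occurs in both \<open>N[x]\<close> and \<open>N[y]\<close>, Hall's condition fails for it only when a single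
  vertex is its only occurrence in either set, and that vertex is a common neighbour because \<open>x\<close>
  and \<open>y\<close> are not adjacent.

  For such a colouring \<open>p = q - 1\<close> and \<open>d = 2 q - 3\<close> give \<open>s x \<ge> 1\<close>. For a map with near-perfect
  \<open>L\<^sub>b\<close> the equality \<open>2 p = d + s x\<close> gives that \<open>s x\<close> is odd, and again \<open>s x \<ge> 1\<close>. In both cases
  every \<open>b \<in> D\<close> is on at most one solitary edge, and since \<open>|I| = |D|\<close> the count of solitary edges
  from both sides forces exactly one at every vertex (\<open>solitary_edges_squeeze\<close>). So the solitary
  edges are the defect matching; in the first case equality in the palette bound makes every
  \<open>L\<^sub>b\<close> near-perfect, and in the second it yields \<open>p = q - 1\<close>, whence exactly one colour is left
  for \<open>x\<close>.
\<close>

section \<open>Flipping coordinates\<close>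

abbreviation flip :: "bit ^ 'd::finite \<Rightarrow> 'd \<Rightarrow> bit ^ 'd"
  where "flip x j \<equiv> x + axis j 1"

lemma flip_nth: "flip x j $ k = (if k = j then x $ k + 1 else x $ k)"
  by (simp add: axis_def)

lemma flip_nth_neq_iff: "x $ k \<noteq> flip x j $ k \<longleftrightarrow> k = j"
  unfolding flip_nth by (cases "x $ k") auto

lemma flip_flip [simp]:
  fixes x :: "bit ^ 'd::finite"
  shows "flip (flip x j) j = x"
proof -
  have "axis j 1 + axis j 1 = (0 :: bit ^ 'd)"
    by (simp add: vec_eq_iff axis_def)
  then show ?thesis
    by (simp add: add.assoc)
qed

lemma flip_commute: "flip (flip x j) l = flip (flip x l) j"
  by (simp only: add.assoc add.commute[of "axis j 1"])

lemma axis_one_inject [simp]: "axis j (1::bit) = axis l 1 \<longleftrightarrow> j = l"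
  by (auto simp: axis_eq_axis)

lemma flip_neq [simp]: "flip x j \<noteq> x" "x \<noteq> flip x j"
  by auto

lemma cube_adj_iff_flip: "cube_adj x y \<longleftrightarrow> (\<exists>j. y = flip x j)"
proof
  assume "cube_adj x y"
  then obtain j where j: "x $ j \<noteq> y $ j" "\<And>k. x $ k \<noteq> y $ k \<Longrightarrow> k = j"
    unfolding cube_adj_def by blast
  have "y = flip x j"
    unfolding vec_eq_iff
  proof
    fix k
    have "x $ k \<noteq> y $ k \<longleftrightarrow> x $ k \<noteq> flip x j $ k"
      unfolding flip_nth_neq_iff using j by blast
    then show "y $ k = flip x j $ k"
      by (metis bit_not_zero_iff)
  qed
  then show "\<exists>j. y = flip x j" ..
next
  assume "\<exists>j. y = flip x j"
  then show "cube_adj x y"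
    unfolding cube_adj_def using flip_nth_neq_iff by metis
qed

lemma mem_closed_nbhd_iff: "y \<in> closed_nbhd x \<longleftrightarrow> y = x \<or> (\<exists>j. y = flip x j)"
  by (auto simp: closed_nbhd_def open_nbhd_def cube_adj_iff_flip)

lemma even_hamming_weight_flip:
  "even (hamming_weight (flip x j)) \<longleftrightarrow> odd (hamming_weight x)"
proof (cases "x $ j = 0")
  case True
  then have "{k. flip x j $ k \<noteq> 0} = insert j {k. x $ k \<noteq> 0}"
    unfolding flip_nth by auto
  then show ?thesis
    using True by (simp add: hamming_weight_def)
next
  case False
  then have "{k. x $ k \<noteq> 0} = insert j {k. flip x j $ k \<noteq> 0}"
    unfolding flip_nth by auto
  moreover have "flip x j $ j = 0"
    using False unfolding flip_nth by (cases "x $ j") auto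
  ultimately show ?thesis
    by (simp add: hamming_weight_def del: vector_add_component)
qed

section \<open>Solitary points of a map\<close>

definition solitary :: "('a \<Rightarrow> 'b) \<Rightarrow> 'a set"
  where "solitary h = {j. \<forall>l. h l = h j \<longrightarrow> l = j}"

lemma solitaryD: "j \<in> solitary h \<Longrightarrow> h l = h j \<Longrightarrow> l = j"
  unfolding solitary_def by blast

lemma card_fibre_plus_solitary:
  fixes h :: "'a::finite \<Rightarrow> 'b"
  shows "CARD('a) + card (solitary h) =
    (\<Sum>i\<in>range h. card (h -` {i}) + card (h -` {i} \<inter> solitary h))"
proof -
  have split: "card A = (\<Sum>i\<in>range h. card (h -` {i} \<inter> A))" for A
  proof -
    have "card (\<Union>i\<in>range h. h -` {i} \<inter> A) = (\<Sum>i\<in>range h. card (h -` {i} \<inter> A))"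
      by (rule card_UN_disjoint) auto
    moreover have "(\<Union>i\<in>range h. h -` {i} \<inter> A) = A"
      by auto
    ultimately show ?thesis by simp
  qed
  show ?thesis
    using split[of UNIV] split[of "solitary h"] by (simp add: sum.distrib)
qed

text \<open>
  A fibre with one element consists of a solitary point and counts twice in the sum above; every
  other nonempty fibre has at least two elements.
\<close>

lemma fibre_weight:
  fixes h :: "'a::finite \<Rightarrow> 'b"
  assumes "i \<in> range h"
  shows "2 \<le> card (h -` {i}) + card (h -` {i} \<inter> solitary h)"
    and "card (h -` {i}) + card (h -` {i} \<inter> solitary h) = 2 \<longleftrightarrow> card (h -` {i}) \<le> 2"
proof -
  obtain j where j: "j \<in> h -` {i}"
    using assms by auto
  have pos: "card (h -` {i}) > 0"
    using j by (auto simp: card_gt_0_iff)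
  have *: "card (h -` {i} \<inter> solitary h) = (if card (h -` {i}) = 1 then 1 else 0)"
  proof (cases "card (h -` {i}) = 1")
    case True
    then have "h -` {i} = {j}"
      using j by (metis card_1_singletonE singletonD)
    moreover from this have "j \<in> solitary h"
      by (auto simp: solitary_def)
    ultimately have "h -` {i} \<inter> solitary h = {j}"
      by blast
    then show ?thesis
      using True by simp
  next
    case False
    have "k \<notin> solitary h" if "k \<in> h -` {i}" for k
    proof
      assume "k \<in> solitary h"
      then have "l = k" if "l \<in> h -` {i}" for l
        using that \<open>k \<in> h -` {i}\<close> by (intro solitaryD[of k h]) auto
      then have "h -` {i} = {k}"
        using \<open>k \<in> h -` {i}\<close> by blast
      then show False
        using False by simp
    qed
    then have "h -` {i} \<inter> solitary h = {}"
      by blast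
    then show ?thesis
      using False by simp
  qed
  show "2 \<le> card (h -` {i}) + card (h -` {i} \<inter> solitary h)"
    using * pos by auto
  show "card (h -` {i}) + card (h -` {i} \<inter> solitary h) = 2 \<longleftrightarrow> card (h -` {i}) \<le> 2"
    using * pos by auto
qed

lemma palette_bound:
  fixes h :: "'a::finite \<Rightarrow> 'b"
  shows "2 * card (range h) \<le> CARD('a) + card (solitary h)"
proof -
  have "(\<Sum>i\<in>range h. 2) \<le> CARD('a) + card (solitary h)"
    unfolding card_fibre_plus_solitary by (rule sum_mono) (rule fibre_weight)
  then show ?thesis by simp
qed

lemma palette_bound_tight_iff:
  fixes h :: "'a::finite \<Rightarrow> 'b"
  shows "2 * card (range h) = CARD('a) + card (solitary h) \<longleftrightarrow> (\<forall>i. card (h -` {i}) \<le> 2)"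
proof -
  let ?w = "\<lambda>i. card (h -` {i}) + card (h -` {i} \<inter> solitary h)"
  have "2 * card (range h) = CARD('a) + card (solitary h) \<longleftrightarrow> (\<Sum>i\<in>range h. 2) = sum ?w (range h)"
    unfolding card_fibre_plus_solitary by (simp add: mult.commute)
  also have "\<dots> \<longleftrightarrow> (\<forall>i\<in>range h. ?w i = 2)"
  proof
    assume eq: "(\<Sum>i\<in>range h. 2) = sum ?w (range h)"
    have "2 = ?w i" if "i \<in> range h" for i
      by (rule sum_mono_inv[OF eq fibre_weight(1) that]) simp_all
    then show "\<forall>i\<in>range h. ?w i = 2"
      by simp
  next
    assume w: "\<forall>i\<in>range h. ?w i = 2"
    show "(\<Sum>i\<in>range h. 2) = sum ?w (range h)"
      by (rule sum.cong[OF refl], rule sym, rule bspec[OF w])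
  qed
  also have "\<dots> \<longleftrightarrow> (\<forall>i\<in>range h. card (h -` {i}) \<le> 2)"
    by (rule ball_cong[OF refl fibre_weight(2)])
  also have "\<dots> \<longleftrightarrow> (\<forall>i. card (h -` {i}) \<le> 2)"
  proof -
    have "card (h -` {i}) \<le> 2" if "i \<notin> range h" for i
    proof -
      have "h -` {i} = {}"
        using that by blast
      then show ?thesis
        by simp
    qed
    then show ?thesis
      by blast
  qed
  finally show ?thesis .
qed

section \<open>Solitary edges and near-perfect matchings\<close>

text \<open>
  The coordinates in the neighbourhood of \<open>x\<close> are coloured by \<open>nbr_colour g x\<close>, so that
  \<open>j \<in> solitary (nbr_colour g x)\<close> says that the edge between \<open>x\<close> and \<open>flip x j\<close> is solitary.
\<close>

definition nbr_colour :: "(bit ^ 'd::finite \<Rightarrow> nat) \<Rightarrow> bit ^ 'd \<Rightarrow> 'd \<Rightarrow> nat"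
  where "nbr_colour g x j = g (flip x j)"

lemma nbr_colour_flip [simp]: "nbr_colour g (flip x j) j = g x"
  by (simp add: nbr_colour_def)

lemma uncovered_iff_solitary:
  "j \<notin> \<Union>(repeat_pairs g b) \<longleftrightarrow> j \<in> solitary (nbr_colour g (flip b j))"
proof -
  have "j \<in> \<Union>(repeat_pairs g b) \<longleftrightarrow> (\<exists>l. l \<noteq> j \<and> g (flip (flip b j) l) = g b)"
  proof
    assume "j \<in> \<Union>(repeat_pairs g b)"
    then obtain k l where "j = k \<or> j = l" "k \<noteq> l" "g (flip (flip b k) l) = g b"
      unfolding repeat_pairs_def by blast
    then show "\<exists>l. l \<noteq> j \<and> g (flip (flip b j) l) = g b"
      using flip_commute[of b k l] by metis
  next
    assume "\<exists>l. l \<noteq> j \<and> g (flip (flip b j) l) = g b"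
    then obtain l where "l \<noteq> j" "g (flip (flip b j) l) = g b"
      by blast
    then have "{j, l} \<in> repeat_pairs g b"
      unfolding repeat_pairs_def by blast
    then show "j \<in> \<Union>(repeat_pairs g b)"
      by blast
  qed
  then show ?thesis
    unfolding solitary_def mem_Collect_eq nbr_colour_flip by (metis nbr_colour_def)
qed

text \<open>
  The colour class of \<open>b\<close> around the neighbour \<open>flip b j\<close> consists of \<open>b\<close> itself, at coordinate
  \<open>j\<close>, and of the partners of \<open>j\<close> in \<open>L\<^sub>b\<close>. Its size is at most two iff \<open>j\<close> has at most one partner.
\<close>

lemma disjoint_repeat_pairs_iff:
  "pairwise disjnt (repeat_pairs g b) \<longleftrightarrow>
    (\<forall>j. card (nbr_colour g (flip b j) -` {g b}) \<le> 2)"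
proof -
  let ?R = "\<lambda>j l. l \<noteq> j \<and> g (flip (flip b j) l) = g b"
  have sym: "?R j l \<Longrightarrow> ?R l j" for j l
    using flip_commute[of b j l] by metis
  have mem: "e \<in> repeat_pairs g b \<longleftrightarrow> (\<exists>j l. e = {j, l} \<and> ?R j l)" for e
    unfolding repeat_pairs_def by blast
  have "pairwise disjnt (repeat_pairs g b) \<longleftrightarrow> (\<forall>j k l. ?R j k \<longrightarrow> ?R j l \<longrightarrow> k = l)"
  proof
    assume dis: "pairwise disjnt (repeat_pairs g b)"
    show "\<forall>j k l. ?R j k \<longrightarrow> ?R j l \<longrightarrow> k = l"
    proof (intro allI impI)
      fix j k l assume "?R j k" "?R j l"
      then have "{j, k} \<in> repeat_pairs g b" "{j, l} \<in> repeat_pairs g b"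
        unfolding mem by blast+
      then have "{j, k} = {j, l}"
        using dis by (metis disjnt_iff insertI1 pairwiseD)
      then show "k = l"
        by (auto simp: doubleton_eq_iff)
    qed
  next
    assume uniq: "\<forall>j k l. ?R j k \<longrightarrow> ?R j l \<longrightarrow> k = l"
    have eq: "e = {j, l}" if e: "e \<in> repeat_pairs g b" "j \<in> e" "?R j l" for e j l
    proof -
      obtain j' l' where e': "e = {j', l'}" "?R j' l'"
        using e(1) unfolding mem by blast
      consider "j = j'" | "j = l'"
        using e(2) e'(1) by blast
      then show ?thesis
      proof cases
        case 1
        then show ?thesis using uniq e' e(3) by blast
      next
        case 2
        then have "?R j j'" using sym[OF e'(2)] by simp
        then have "j' = l" using uniq e(3) by blast
        then show ?thesis using e' 2 by blast
      qed
    qed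
    show "pairwise disjnt (repeat_pairs g b)"
    proof (rule pairwiseI)
      fix e e' assume ee: "e \<in> repeat_pairs g b" "e' \<in> repeat_pairs g b" "e \<noteq> e'"
      show "disjnt e e'"
      proof (rule ccontr)
        assume "\<not> disjnt e e'"
        then obtain j where j: "j \<in> e" "j \<in> e'"
          by (auto simp: disjnt_def)
        obtain l where "?R j l"
          using ee(1) j(1) sym unfolding mem by blast
        then show False
          using eq[OF ee(1) j(1)] eq[OF ee(2) j(2)] ee(3) by blast
      qed
    qed
  qed
  also have "\<dots> \<longleftrightarrow> (\<forall>j. card (nbr_colour g (flip b j) -` {g b} - {j}) \<le> 1)"
    unfolding One_nat_def card_le_Suc0_iff_eq[OF finite]
    by (simp add: nbr_colour_def Ball_def) blast
  also have "\<dots> \<longleftrightarrow> (\<forall>j. card (nbr_colour g (flip b j) -` {g b}) \<le> 2)"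
  proof -
    have "card (nbr_colour g (flip b j) -` {g b}) =
        Suc (card (nbr_colour g (flip b j) -` {g b} - {j}))" for j
      by (rule card.remove) simp_all
    then show ?thesis
      by (simp only: numeral_2_eq_2 One_nat_def Suc_le_mono)
  qed
  finally show ?thesis .
qed

text \<open>
  Being solitary is a condition at the end \<open>flip b j\<close> of an edge; these are the solitary edges
  indexed by their other end \<open>b\<close>, the one whose colour is not repeated.
\<close>

definition solitary_edges_at :: "(bit ^ 'd::finite \<Rightarrow> nat) \<Rightarrow> bit ^ 'd \<Rightarrow> 'd set"
  where "solitary_edges_at g b = {j. j \<in> solitary (nbr_colour g (flip b j))}"

lemma near_perfect_repeat_pairs_iff:
  "near_perfect_matching (repeat_pairs g b) \<longleftrightarrow>
    (\<forall>j. card (nbr_colour g (flip b j) -` {g b}) \<le> 2) \<and> card (solitary_edges_at g b) = 1"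
proof -
  have "\<forall>e\<in>repeat_pairs g b. card e = 2"
    by (auto simp: repeat_pairs_def)
  moreover have uncovered: "(\<exists>!j. j \<notin> \<Union>(repeat_pairs g b)) \<longleftrightarrow> card (solitary_edges_at g b) = 1"
    unfolding uncovered_iff_solitary solitary_edges_at_def One_nat_def card_1_singleton_iff
    by (auto simp: set_eq_iff)
  ultimately show ?thesis
    unfolding near_perfect_matching_def disjoint_repeat_pairs_iff uncovered by blast
qed

lemma solitary_edges_at_eq_defect:
  assumes "near_perfect_matching (repeat_pairs g b)"
  shows "solitary_edges_at g b = {defect g b}"
proof -
  obtain j where j: "solitary_edges_at g b = {j}"
    using assms unfolding near_perfect_repeat_pairs_iff by (metis card_1_singletonE)
  then have "defect g b = j"
    unfolding defect_def uncovered_iff_solitary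
    by (intro the_equality) (auto simp: solitary_edges_at_def)
  then show ?thesis
    using j by simp
qed

section \<open>The two sides of the cube\<close>

text \<open>
  Parity classes enter only through the fact that they alternate along edges, which treats \<open>I\<close> and
  its complement alike.
\<close>

locale bipartition =
  fixes I :: "(bit ^ 'd::finite) set"
  assumes flip_mem [simp]: "flip x j \<in> I \<longleftrightarrow> x \<notin> I"
begin

lemma card_sides: "card I = card (- I)"
proof -
  fix j :: 'd
  have "bij_betw (\<lambda>x. flip x j) I (- I)"
    by (rule bij_betwI[where g = "\<lambda>x. flip x j"]) auto
  then show ?thesis
    by (rule bij_betw_same_card)
qed

lemma I_nonempty: "I \<noteq> {}"
proof
  assume "I = {}"
  then show False
    using flip_mem[of 0 undefined] by simp
qed

lemma count_solitary_edges:
  "(\<Sum>x\<in>I. card (solitary (nbr_colour g x))) = (\<Sum>b\<in>-I. card (solitary_edges_at g b))"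
proof -
  have "(\<Sum>x\<in>I. card (solitary (nbr_colour g x))) = card (SIGMA x:I. solitary (nbr_colour g x))"
    by simp
  also have "\<dots> = card (SIGMA b:-I. solitary_edges_at g b)"
    by (rule bij_betw_same_card[of "\<lambda>(x, j). (flip x j, j)"],
        rule bij_betwI[where g = "\<lambda>(x, j). (flip x j, j)"])
       (auto simp: solitary_edges_at_def)
  also have "\<dots> = (\<Sum>b\<in>-I. card (solitary_edges_at g b))"
    by simp
  finally show ?thesis .
qed

text \<open>
  The two sides have the same size, so the lower bound on one and the upper bound on the other
  leave no slack in the double count.
\<close>

lemma solitary_edges_squeeze:
  assumes "\<And>x. x \<in> I \<Longrightarrow> 1 \<le> card (solitary (nbr_colour g x))"
    and "\<And>b. b \<notin> I \<Longrightarrow> card (solitary_edges_at g b) \<le> 1"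
  shows "x \<in> I \<Longrightarrow> card (solitary (nbr_colour g x)) = 1"
    and "b \<notin> I \<Longrightarrow> card (solitary_edges_at g b) = 1"
proof -
  let ?s = "\<lambda>x. card (solitary (nbr_colour g x))" and ?t = "\<lambda>b. card (solitary_edges_at g b)"
  have "(\<Sum>x\<in>I. 1) \<le> sum ?s I"
    by (rule sum_mono) (rule assms(1))
  moreover have "sum ?t (- I) \<le> (\<Sum>b\<in>-I. 1)"
    by (rule sum_mono) (use assms(2) in auto)
  moreover have "(\<Sum>x\<in>I. 1) = (\<Sum>b\<in>-I. 1::nat)"
    using card_sides by simp
  ultimately have s: "(\<Sum>x\<in>I. 1) = sum ?s I" and t: "sum ?t (- I) = (\<Sum>b\<in>-I. 1)"
    using count_solitary_edges[of g] by linarith+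
  show "?s x = 1" if "x \<in> I"
    using sum_mono_inv[OF s assms(1) that] by simp
  show "?t b = 1" if "b \<notin> I"
    using sum_mono_inv[OF t, of b] assms(2) that by simp
qed

section \<open>Pair-defence in terms of solitary edges\<close>

text \<open>
  The second conjunct is Hall's condition at pairs: if two edges at \<open>b\<close> were solitary, \<open>b\<close> would be
  the only defender of its colour for both of their other ends.
\<close>

definition locally_defensive :: "nat \<Rightarrow> (bit ^ 'd \<Rightarrow> nat) \<Rightarrow> bool"
  where "locally_defensive q c \<longleftrightarrow>
    (\<forall>x\<in>I. c x \<in> {1..q} \<and> range (nbr_colour c x) = {1..q} - {c x}) \<and>
    (\<forall>b\<in>-I. card (solitary_edges_at c b) \<le> 1)"

lemma pair_defensive_imp_locally_defensive:
  assumes "pair_defensive_colouring I q c"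
  shows "locally_defensive q c"
proof -
  have col: "c x \<in> {1..q}" for x
    using assms unfolding pair_defensive_colouring_def by blast
  have proper: "c (flip x j) \<noteq> c x" for x j
    using assms unfolding pair_defensive_colouring_def cube_adj_iff_flip by metis
  have hall: "\<exists>f. f \<in> S \<rightarrow> colour_class c i \<and> inj_on f S \<and> (\<forall>x\<in>S. f x \<in> closed_nbhd x)"
    if "i \<in> {1..q}" "S \<subseteq> I" "card S \<le> 2" for i S
    using assms that unfolding pair_defensive_colouring_def by blast
  have "range (nbr_colour c x) = {1..q} - {c x}" if x: "x \<in> I" for x
  proof
    show "range (nbr_colour c x) \<subseteq> {1..q} - {c x}"
      using col proper by (auto simp: nbr_colour_def)
    show "{1..q} - {c x} \<subseteq> range (nbr_colour c x)"
    proof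
      fix i assume i: "i \<in> {1..q} - {c x}"
      then obtain f where "f \<in> {x} \<rightarrow> colour_class c i" "f x \<in> closed_nbhd x"
        using hall[of i "{x}"] x by auto
      then show "i \<in> range (nbr_colour c x)"
        using i by (auto simp: mem_closed_nbhd_iff colour_class_def nbr_colour_def)
    qed
  qed
  moreover have "card (solitary_edges_at c b) \<le> 1" if b: "b \<notin> I" for b
  proof -
    have "j = l" if jl: "j \<in> solitary_edges_at c b" "l \<in> solitary_edges_at c b" for j l
    proof (rule ccontr)
      assume "j \<noteq> l"
      have "card {flip b j, flip b l} \<le> 2"
        by (simp add: card_insert_if)
      then obtain f where f: "f \<in> {flip b j, flip b l} \<rightarrow> colour_class c (c b)"
          "inj_on f {flip b j, flip b l}"
          "\<And>x. x \<in> {flip b j, flip b l} \<Longrightarrow> f x \<in> closed_nbhd x"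
        using hall[of "c b" "{flip b j, flip b l}"] col b by auto
      \<comment> \<open>A solitary edge at \<open>b\<close> leaves \<open>b\<close> as the only defender of colour \<open>c b\<close> for its other end.\<close>
      have only: "f (flip b k) = b" if k: "k \<in> {j, l}" for k
      proof -
        have "c (f (flip b k)) = c b"
          using f(1) k by (auto simp: colour_class_def)
        moreover obtain m where "f (flip b k) = flip (flip b k) m"
          using f(3)[of "flip b k"] k calculation proper by (auto simp: mem_closed_nbhd_iff)
        moreover have "k \<in> solitary (nbr_colour c (flip b k))"
          using jl k by (auto simp: solitary_edges_at_def)
        ultimately have "m = k"
          by (intro solitaryD[of k "nbr_colour c (flip b k)"]) (simp_all add: nbr_colour_def)
        then show ?thesis
          using \<open>f (flip b k) = flip (flip b k) m\<close> by simp
      qed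
      have "f (flip b j) = f (flip b l)"
        using only by simp
      then have "flip b j = flip b l"
        using f(2) by (meson inj_onD insertI1 insertI2)
      then show False
        using \<open>j \<noteq> l\<close> by simp
    qed
    then show ?thesis
      unfolding One_nat_def card_le_Suc0_iff_eq[OF finite] by blast
  qed
  ultimately show ?thesis
    using col by (auto simp: locally_defensive_def)
qed

lemma locally_defensive_defender:
  assumes "locally_defensive q c" "z \<in> I" "i \<in> {1..q}"
  shows "\<exists>u. u \<in> closed_nbhd z \<inter> colour_class c i"
proof (cases "c z = i")
  case True
  then show ?thesis by (auto simp: mem_closed_nbhd_iff colour_class_def)
next
  case False
  then have "i \<in> range (nbr_colour c z)"
    using assms by (auto simp: locally_defensive_def)
  then show ?thesis
    by (auto simp: mem_closed_nbhd_iff colour_class_def nbr_colour_def)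
qed

text \<open>
  If the only defender of both \<open>x\<close> and \<open>y\<close> in some colour were the same vertex \<open>u\<close>, then \<open>u\<close>
  would be a common neighbour, since \<open>x\<close> and \<open>y\<close> are not adjacent, and both edges at \<open>u\<close>
  would be solitary.
\<close>

lemma distinct_defenders:
  assumes c: "locally_defensive q c" and i: "i \<in> {1..q}"
    and xy: "x \<in> I" "y \<in> I" "x \<noteq> y"
  shows "\<exists>u\<in>closed_nbhd x \<inter> colour_class c i. \<exists>v\<in>closed_nbhd y \<inter> colour_class c i. u \<noteq> v"
proof (rule ccontr)
  assume "\<not> ?thesis"
  then have same: "u = v" if "u \<in> closed_nbhd x \<inter> colour_class c i"
      "v \<in> closed_nbhd y \<inter> colour_class c i" for u v
    using that by blast
  obtain u where u: "u \<in> closed_nbhd x \<inter> colour_class c i"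
    using locally_defensive_defender[OF c xy(1) i] by blast
  obtain v where "v \<in> closed_nbhd y \<inter> colour_class c i"
    using locally_defensive_defender[OF c xy(2) i] by blast
  with same[OF u] have u': "u \<in> closed_nbhd y \<inter> colour_class c i"
    by blast
  have "u \<noteq> x" "u \<noteq> y"
    using u u' xy flip_mem by (auto simp: mem_closed_nbhd_iff)
  then obtain j l where jl: "u = flip x j" "u = flip y l"
    using u u' by (auto simp: mem_closed_nbhd_iff)
  have ends: "flip u j = x" "flip u l = y"
    using jl by (metis flip_flip)+
  have only: "k \<in> solitary (nbr_colour c z)"
    if k: "u = flip z k" and z: "\<And>v. v \<in> closed_nbhd z \<inter> colour_class c i \<Longrightarrow> v = u" for z k
    unfolding solitary_def
  proof (intro CollectI allI impI)
    fix m assume "nbr_colour c z m = nbr_colour c z k"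
    then have "flip z m \<in> closed_nbhd z \<inter> colour_class c i"
      using u k by (auto simp: nbr_colour_def mem_closed_nbhd_iff colour_class_def)
    then have "flip z m = flip z k"
      using z k by metis
    then show "m = k" by simp
  qed
  have "j \<in> solitary (nbr_colour c x)"
    by (rule only[OF jl(1)]) (rule same[OF _ u'])
  moreover have "l \<in> solitary (nbr_colour c y)"
    by (rule only[OF jl(2)]) (rule same[OF u, symmetric])
  ultimately have "j \<in> solitary_edges_at c u" "l \<in> solitary_edges_at c u"
    using ends by (auto simp: solitary_edges_at_def)
  moreover have "card (solitary_edges_at c u) \<le> 1"
    using c jl(1) xy by (auto simp: locally_defensive_def)
  ultimately have "j = l"
    unfolding One_nat_def card_le_Suc0_iff_eq[OF finite] by blast
  then show False
    using ends xy by blast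
qed

lemma locally_defensive_imp_pair_defensive:
  assumes c: "locally_defensive q c"
  shows "pair_defensive_colouring I q c"
  unfolding pair_defensive_colouring_def
proof (intro conjI ballI allI impI)
  have pal: "range (nbr_colour c x) = {1..q} - {c x}" "c x \<in> {1..q}" if "x \<in> I" for x
    using c that by (auto simp: locally_defensive_def)
  have nbr: "c (flip x j) \<in> {1..q} - {c x}" if "x \<in> I" for x j
    using rangeI[of "nbr_colour c x" j] unfolding pal(1)[OF that] by (simp add: nbr_colour_def)
  have col: "c x \<in> {1..q}" for x
    using pal(2) nbr[of "flip x undefined" undefined] by (cases "x \<in> I") auto
  show "range c = {1..q}"
  proof
    show "range c \<subseteq> {1..q}"
      using col by blast
    obtain x where "x \<in> I"
      using I_nonempty by blast
    moreover have "range (nbr_colour c x) \<subseteq> range c"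
      by (auto simp: nbr_colour_def)
    ultimately have "{1..q} - {c x} \<subseteq> range c"
      by (simp only: pal(1))
    then show "{1..q} \<subseteq> range c"
      by blast
  qed
  fix x y :: "bit ^ 'd"
  assume "cube_adj x y"
  then obtain j where j: "y = flip x j"
    by (auto simp: cube_adj_iff_flip)
  show "c x \<noteq> c y"
    using nbr[of x j] nbr[of "flip x j" j] by (cases "x \<in> I") (simp_all add: j)
next
  fix i and S :: "(bit ^ 'd) set"
  assume i: "i \<in> {1..q}" and "S \<subseteq> I \<and> card S \<le> 2"
  then have S: "S \<subseteq> I" "card S \<le> 2" by auto
  let ?C = "colour_class c i"
  have ex: "\<exists>u. u \<in> closed_nbhd z \<inter> ?C" if "z \<in> I" for z
    using locally_defensive_defender[OF c that i] .
  consider "S = {}" | x where "S = {x}" | x y where "S = {x, y}" "x \<noteq> y"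
  proof -
    have "card S = 0 \<or> card S = 1 \<or> card S = 2"
      using S(2) by linarith
    then show ?thesis
      using that by (metis card_0_eq card_1_singletonE card_2_iff finite)
  qed
  then show "\<exists>f. f \<in> S \<rightarrow> ?C \<and> inj_on f S \<and> (\<forall>x\<in>S. f x \<in> closed_nbhd x)"
  proof cases
    case 1
    then show ?thesis by simp
  next
    case 2
    then obtain u where "u \<in> closed_nbhd x \<inter> ?C"
      using ex S(1) by blast
    with 2 show ?thesis
      by (intro exI[of _ "\<lambda>_. u"]) auto
  next
    case 3
    then obtain u v where "u \<in> closed_nbhd x \<inter> ?C" "v \<in> closed_nbhd y \<inter> ?C" "u \<noteq> v"
      using distinct_defenders[OF c i, of x y] S(1) by blast
    with 3 show ?thesis
      by (intro exI[of _ "\<lambda>z. if z = x then u else v"]) auto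
  qed
qed

lemma pair_defensive_iff: "pair_defensive_colouring I q c \<longleftrightarrow> locally_defensive q c"
  using pair_defensive_imp_locally_defensive locally_defensive_imp_pair_defensive by blast

lemma card_pair_defenders:
  assumes "pair_defensive_colouring I q c" "i \<in> {1..q}" "x \<in> I" "y \<in> I" "x \<noteq> y"
  shows "2 \<le> card (closed_nbhd_set {x, y} \<inter> colour_class c i)"
proof -
  obtain u v where uv: "u \<in> closed_nbhd x \<inter> colour_class c i"
      "v \<in> closed_nbhd y \<inter> colour_class c i" "u \<noteq> v"
    using distinct_defenders assms unfolding pair_defensive_iff by blast
  then have "{u, v} \<subseteq> closed_nbhd_set {x, y} \<inter> colour_class c i"
    by (auto simp: closed_nbhd_set_def)
  then have "card {u, v} \<le> card (closed_nbhd_set {x, y} \<inter> colour_class c i)"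
    by (intro card_mono) simp_all
  then show ?thesis
    using uv(3) by simp
qed

section \<open>Restricting to the defender side\<close>

lemma nbr_colour_restrict [simp]:
  "x \<in> I \<Longrightarrow> nbr_colour (restrict c (- I)) x = nbr_colour c x"
  by (auto simp: nbr_colour_def fun_eq_iff)

lemma repeat_pairs_restrict [simp]:
  "b \<notin> I \<Longrightarrow> repeat_pairs (restrict c (- I)) b = repeat_pairs c b"
  by (simp add: repeat_pairs_def)

lemma solitary_edges_at_restrict [simp]:
  "b \<notin> I \<Longrightarrow> solitary_edges_at (restrict c (- I)) b = solitary_edges_at c b"
  by (simp add: solitary_edges_at_def)

text \<open>
  With \<open>q - 1\<close> colours on \<open>2 q - 3\<close> neighbours the palette bound forces a solitary edge at every
  vertex of \<open>I\<close>. The double count makes it the only one, so the bound is attained, no colour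
  occurs more than twice, and each vertex of the other side also has exactly one solitary edge.
\<close>

lemma locally_defensive_near_perfect:
  assumes c: "locally_defensive q c" and q: "q \<ge> 2" "CARD('d) = 2 * q - 3" and b: "b \<notin> I"
  shows "near_perfect_matching (repeat_pairs c b)"
proof -
  have palette: "card (range (nbr_colour c x)) = q - 1" if "x \<in> I" for x
    using c that by (simp add: locally_defensive_def)
  have lower: "1 \<le> card (solitary (nbr_colour c x))" if "x \<in> I" for x
    using palette_bound[of "nbr_colour c x"] palette[OF that] q by linarith
  have upper: "card (solitary_edges_at c b) \<le> 1" if "b \<notin> I" for b
    using c that by (simp add: locally_defensive_def)
  have one_I: "card (solitary (nbr_colour c x)) = 1" if "x \<in> I" for x
    by (rule solitary_edges_squeeze(1)[OF _ _ that]; (erule lower | erule upper))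
  have one_D: "card (solitary_edges_at c b) = 1"
    by (rule solitary_edges_squeeze(2)[OF _ _ b]; (erule lower | erule upper))
  have "card (nbr_colour c x -` {i}) \<le> 2" if "x \<in> I" for x i
  proof -
    have "2 * card (range (nbr_colour c x)) = CARD('d) + card (solitary (nbr_colour c x))"
      using palette[OF that] one_I[OF that] q by simp
    then show ?thesis
      unfolding palette_bound_tight_iff ..
  qed
  then show ?thesis
    using one_D b by (simp add: near_perfect_repeat_pairs_iff)
qed

lemma restrict_in_matching_maps:
  assumes "locally_defensive q c" "q \<ge> 2" "CARD('d) = 2 * q - 3"
  shows "restrict c (- I) \<in> matching_maps (- I) q"
proof -
  have "c b \<in> {1..q}" if b: "b \<notin> I" for b
  proof -
    fix j
    have "nbr_colour c (flip b j) j \<in> {1..q}"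
      using assms(1) b unfolding locally_defensive_def by (metis Diff_iff flip_mem rangeI)
    then show ?thesis by simp
  qed
  then show ?thesis
    using locally_defensive_near_perfect[OF assms] by (simp add: matching_maps_def)
qed

section \<open>Extending from the defender side\<close>

context
  fixes g q
  assumes g: "g \<in> matching_maps (- I) q" and q: "q \<ge> 2" "CARD('d) = 2 * q - 3"
begin

lemma matching_map_near_perfect: "b \<notin> I \<Longrightarrow> near_perfect_matching (repeat_pairs g b)"
  using g by (simp add: matching_maps_def)

text \<open>
  A colour class around \<open>x\<close> contains some neighbour \<open>b\<close> of \<open>x\<close>, and disjointness of the pairs in
  \<open>L\<^sub>b\<close> bounds its size by two.
\<close>

lemma matching_map_palette_card:
  assumes "x \<in> I"
  shows "2 * card (range (nbr_colour g x)) = CARD('d) + card (solitary (nbr_colour g x))"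
  unfolding palette_bound_tight_iff
proof
  fix i
  show "card (nbr_colour g x -` {i}) \<le> 2"
  proof (cases "i \<in> range (nbr_colour g x)")
    case True
    then obtain j where "i = g (flip x j)"
      by (auto simp: nbr_colour_def)
    moreover have "\<forall>l. card (nbr_colour g (flip (flip x j) l) -` {g (flip x j)}) \<le> 2"
      using matching_map_near_perfect[of "flip x j"] assms
      by (simp add: near_perfect_repeat_pairs_iff)
    ultimately show ?thesis
      by (metis flip_flip)
  next
    case False
    then have "nbr_colour g x -` {i} = {}" by blast
    then show ?thesis by simp
  qed
qed

text \<open>The dimension is odd, so the palette equation makes the number of solitary edges odd.\<close>

lemma matching_map_one_solitary:
  assumes "x \<in> I"
  shows "card (solitary (nbr_colour g x)) = 1"
proof (rule solitary_edges_squeeze(1)[OF _ _ assms])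
  fix x assume "x \<in> I"
  then have "even (CARD('d) + card (solitary (nbr_colour g x)))"
    by (metis matching_map_palette_card dvd_triv_left)
  moreover have "odd (CARD('d))"
    using q by simp
  ultimately have "odd (card (solitary (nbr_colour g x)))"
    by simp
  then show "1 \<le> card (solitary (nbr_colour g x))"
    using odd_pos by fastforce
next
  fix b assume "b \<notin> I"
  then show "card (solitary_edges_at g b) \<le> 1"
    using matching_map_near_perfect[of b] by (simp add: near_perfect_repeat_pairs_iff)
qed

lemma matching_map_missing_colour:
  assumes x: "x \<in> I"
  shows "\<exists>i. {1..q} - range (nbr_colour g x) = {i}"
proof -
  have "card (range (nbr_colour g x)) = q - 1"
    using matching_map_palette_card[OF x] matching_map_one_solitary[OF x] q by simp
  moreover have "range (nbr_colour g x) \<subseteq> {1..q}"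
    using g x by (auto simp: matching_maps_def nbr_colour_def)
  ultimately have "card ({1..q} - range (nbr_colour g x)) = 1"
    using q(1) by (simp add: card_Diff_subset)
  then show ?thesis
    by (metis card_1_singletonE)
qed

text \<open>
  A defensive extension has to give \<open>x\<close> the one colour missing around it, and doing so is enough:
  the solitary edges depend on \<open>g\<close> alone.
\<close>

lemma unique_extension: "\<exists>!c. locally_defensive q c \<and> restrict c (- I) = g"
proof -
  obtain m where m: "\<And>x. x \<in> I \<Longrightarrow> {1..q} - range (nbr_colour g x) = {m x}"
    using matching_map_missing_colour by metis
  have sub: "range (nbr_colour g x) \<subseteq> {1..q}" if "x \<in> I" for x
    using g that by (auto simp: matching_maps_def nbr_colour_def)
  let ?c = "\<lambda>x. if x \<in> I then m x else g x"
  have res: "restrict ?c (- I) = g"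
    using g by (auto simp: matching_maps_def PiE_def extensional_def fun_eq_iff)
  have "?c x \<in> {1..q} \<and> range (nbr_colour ?c x) = {1..q} - {?c x}" if x: "x \<in> I" for x
  proof -
    have "range (nbr_colour ?c x) = range (nbr_colour g x)"
      using nbr_colour_restrict[OF x, of ?c] unfolding res by simp
    then show ?thesis
      using m[OF x] sub[OF x] x by auto
  qed
  moreover have "card (solitary_edges_at ?c b) \<le> 1" if b: "b \<notin> I" for b
  proof -
    have "solitary_edges_at ?c b = solitary_edges_at g b"
      using solitary_edges_at_restrict[OF b, of ?c] unfolding res by simp
    then show ?thesis
      using matching_map_near_perfect[OF b] by (simp add: near_perfect_repeat_pairs_iff)
  qed
  ultimately have "locally_defensive q ?c"
    unfolding locally_defensive_def by blast
  moreover have "c = ?c" if c: "locally_defensive q c" "restrict c (- I) = g" for c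
  proof
    fix x
    show "c x = ?c x"
    proof (cases "x \<in> I")
      case True
      then have "c x \<in> {1..q}" "range (nbr_colour g x) = {1..q} - {c x}"
        using c(1) nbr_colour_restrict[OF True, of c] unfolding c(2)
        by (auto simp: locally_defensive_def)
      then have "{1..q} - range (nbr_colour g x) = {c x}"
        by auto
      then show ?thesis
        using m[OF True] True by simp
    next
      case False
      then show ?thesis
        unfolding c(2)[symmetric] by simp
    qed
  qed
  ultimately show ?thesis
    using res by blast
qed

text \<open>
  The edge from \<open>b\<close> to its defect is the solitary edge at \<open>b\<close>, and \<open>x \<in> I\<close> is the other end of
  exactly one solitary edge.
\<close>

lemma defect_perfect_matching:
  "perfect_matching_between (- I) I {{b, flip b (defect g b)} | b. b \<in> - I}"
    (is "perfect_matching_between _ _ ?M")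
proof -
  have defect_iff: "j = defect g (flip x j) \<longleftrightarrow> j \<in> solitary (nbr_colour g x)" if "x \<in> I" for x j
  proof -
    have "j \<in> solitary_edges_at g (flip x j) \<longleftrightarrow> j \<in> solitary (nbr_colour g x)"
      by (simp add: solitary_edges_at_def)
    then show ?thesis
      using solitary_edges_at_eq_defect[OF matching_map_near_perfect, of "flip x j"] that by simp
  qed
  have covered: "\<exists>!e. e \<in> ?M \<and> v \<in> e" for v
  proof (cases "v \<in> I")
    case True
    obtain j where j: "solitary (nbr_colour g v) = {j}"
      using matching_map_one_solitary[OF True] by (metis card_1_singletonE)
    show ?thesis
    proof (rule ex1I[of _ "{flip v j, v}"])
      have "defect g (flip v j) = j"
        using defect_iff[OF True, of j] j by simp
      then show "{flip v j, v} \<in> ?M \<and> v \<in> {flip v j, v}"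
        using True by (auto intro!: exI[of _ "flip v j"])
    next
      fix e assume "e \<in> ?M \<and> v \<in> e"
      then obtain b where b: "b \<notin> I" "e = {b, flip b (defect g b)}" "v = flip b (defect g b)"
        using True by auto
      have b': "b = flip v (defect g b)"
        using b(3) by simp
      then have "defect g b \<in> solitary (nbr_colour g v)"
        using defect_iff[OF True, of "defect g b"] by metis
      then show "e = {flip v j, v}"
        using b b' j by auto
    qed
  next
    case False
    then show ?thesis
      by (intro ex1I[of _ "{v, flip v (defect g v)}"]) auto
  qed
  have crossing: "\<exists>a\<in>-I. \<exists>x\<in>I. e = {a, x} \<and> cube_adj a x" if e: "e \<in> ?M" for e
  proof -
    obtain b where "b \<notin> I" "e = {b, flip b (defect g b)}"
      using e by blast
    moreover from this have "flip b (defect g b) \<in> I"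
      by simp
    moreover have "cube_adj b (flip b (defect g b))"
      unfolding cube_adj_iff_flip by blast
    ultimately show ?thesis
      by blast
  qed
  show ?thesis
    unfolding perfect_matching_between_def
    by (intro conjI ballI; (rule covered | erule crossing))
qed

end

end

lemma bipartition_parity_class: "parity_class I \<Longrightarrow> bipartition I"
  by unfold_locales (auto simp: parity_class_def even_hamming_weight_flip)

section \<open>Extremal colourings and matching maps\<close>

theorem corollary5p4:
  fixes q :: nat and I D :: "(bit ^ 'd::finite) set"
  assumes "q \<ge> 2"
    and "CARD('d) = 2 * q - 3"
    and "parity_class I"
    and "D = - I"
  shows "bij_betw (\<lambda>c. restrict c D) {c. extremal_colouring I q c} (matching_maps D q) \<and>
    (\<forall>g\<in>matching_maps D q.
      (\<exists>!c. extremal_colouring I q c \<and> restrict c D = g) \<and>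
      perfect_matching_between D I {{b, b + axis (defect g b) 1} | b. b \<in> D} \<and>
      (\<forall>c. extremal_colouring I q c \<and> restrict c D = g \<longrightarrow>
        (\<forall>x\<in>I. \<forall>y\<in>I. x \<noteq> y \<longrightarrow>
          (\<forall>i\<in>{1..q}. card (closed_nbhd_set {x, y} \<inter> colour_class c i) \<ge> 2))))"
proof -
  interpret bipartition I
    using assms(3) by (rule bipartition_parity_class)
  have ext: "extremal_colouring I q c \<longleftrightarrow> locally_defensive q c" for c
    using assms(1,2) by (auto simp: extremal_colouring_def pair_defensive_iff)
  have unique: "\<exists>!c. extremal_colouring I q c \<and> restrict c D = g" if "g \<in> matching_maps D q" for g
    using unique_extension[of g q] that assms unfolding ext by blast
  have into: "restrict c D \<in> matching_maps D q" if "extremal_colouring I q c" for c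
    using restrict_in_matching_maps[of q c] that assms unfolding ext by blast
  have bij: "bij_betw (\<lambda>c. restrict c D) {c. extremal_colouring I q c} (matching_maps D q)"
  proof (rule bij_betw_imageI)
    show "inj_on (\<lambda>c. restrict c D) {c. extremal_colouring I q c}"
      using unique into by (auto intro!: inj_onI)
    show "(\<lambda>c. restrict c D) ` {c. extremal_colouring I q c} = matching_maps D q"
    proof
      show "(\<lambda>c. restrict c D) ` {c. extremal_colouring I q c} \<subseteq> matching_maps D q"
        using into by blast
      show "matching_maps D q \<subseteq> (\<lambda>c. restrict c D) ` {c. extremal_colouring I q c}"
      proof
        fix g assume "g \<in> matching_maps D q"
        then obtain c where "extremal_colouring I q c" "restrict c D = g"
          using unique by blast
        then show "g \<in> (\<lambda>c. restrict c D) ` {c. extremal_colouring I q c}"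
          by blast
      qed
    qed
  qed
  have defect: "perfect_matching_between D I {{b, b + axis (defect g b) 1} | b. b \<in> D}"
    if "g \<in> matching_maps D q" for g
    using defect_perfect_matching[of g q] that assms by blast
  have hall: "card (closed_nbhd_set {x, y} \<inter> colour_class c i) \<ge> 2"
    if "extremal_colouring I q c" "x \<in> I" "y \<in> I" "x \<noteq> y" "i \<in> {1..q}" for c x y i
    using card_pair_defenders that unfolding extremal_colouring_def by blast
  show ?thesis
  proof (rule conjI[OF bij], rule ballI)
    fix g assume g: "g \<in> matching_maps D q"
    show "(\<exists>!c. extremal_colouring I q c \<and> restrict c D = g) \<and>
      perfect_matching_between D I {{b, b + axis (defect g b) 1} | b. b \<in> D} \<and>
      (\<forall>c. extremal_colouring I q c \<and> restrict c D = g \<longrightarrow>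
        (\<forall>x\<in>I. \<forall>y\<in>I. x \<noteq> y \<longrightarrow>
          (\<forall>i\<in>{1..q}. card (closed_nbhd_set {x, y} \<inter> colour_class c i) \<ge> 2)))"
      using hall by (simp only: unique[OF g] defect[OF g]) blast
  qed
qed

end
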